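(* There exist two bivariate Cauchy densities $p_{\mu_1,\Sigma_1}$ and $p_{\mu_2,\Sigma_2}$ (with $\mu_1,\mu_2\in\mathbb{R}^2$ and $\Sigma_1,\Sigma_2$ symmetric positive-definite $2\times2$ matrices) such that $$D_{\mathrm{KL}}(p_{\mu_1,\Sigma_1}:p_{\mu_2,\Sigma_2})\neq D_{\mathrm{KL}}(p_{\mu_2,\Sigma_2}:p_{\mu_1,\Sigma_1}).$$
   Context: The $d$-dimensional Cauchy density with parameters $\mu\in\mathbb{R}^d$ and $\Sigma\succ0$ is $p_{\mu,\Sigma}(x)=\frac{C_d}{(\det\Sigma)^{1/2}}\left(1+(x-\mu)^\top\Sigma^{-1}(x-\mu)\right)^{-(d+1)/2}$, $x\in\mathbb{R}^d$, with $C_d=\Gamma\!\left(\frac{d+1}{2}\right)\pi^{-\frac{d+1}{2}}$; bivariate means $d=2$. $D_{\mathrm{KL}}(p:q)=\int_{\mathbb{R}^d}p(x)\log\frac{p(x)}{q(x)}\,dx$. *)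

theory Defs
  imports "HOL-Probability.Probability"
begin

definition sym_pos_def :: "real^'n^'n \<Rightarrow> bool" where
  "sym_pos_def A \<longleftrightarrow> transpose A = A \<and> (\<forall>x. x \<noteq> 0 \<longrightarrow> 0 < x \<bullet> (A *v x))"

definition cauchy_density :: "real^'n \<Rightarrow> real^'n^'n \<Rightarrow> real^'n \<Rightarrow> real" where
  "cauchy_density \<mu> \<Sigma> x =
     (let d = real CARD('n);
          C = Gamma ((d + 1) / 2) * pi powr (- (d + 1) / 2)
      in C / sqrt (det \<Sigma>) *
           (1 + (x - \<mu>) \<bullet> (matrix_inv \<Sigma> *v (x - \<mu>))) powr (- (d + 1) / 2))"

(* The quotient of two Cauchy densities is bounded and bounded away from 0, so
   for them the integrand is integrable and the Bochner integral is the true value. *)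
definition kl_div :: "('a::euclidean_space \<Rightarrow> real) \<Rightarrow> ('a \<Rightarrow> real) \<Rightarrow> real" where
  "kl_div p q = (LINT x|lborel. p x * ln (p x / q x))"

(* KL_divergence takes the reference measure first, so the arguments are swapped. *)
lemma kl_div_eq_KL_divergence:
  fixes p q :: "'a::euclidean_space \<Rightarrow> real"
  assumes "p \<in> borel_measurable borel" "\<And>x. 0 \<le> p x"
      and "q \<in> borel_measurable borel" "\<And>x. 0 < q x"
  shows "kl_div p q = KL_divergence (exp 1) (density lborel q) (density lborel p)"
proof -
  have "KL_divergence (exp 1) (density lborel q) (density lborel p)
      = (LINT x|lborel. p x * log (exp 1) (p x / q x))"
    using assms by (intro lborel.KL_density_density) (auto simp: less_imp_le less_imp_neq[symmetric])
  then show ?thesis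
    by (simp add: kl_div_def log_def)
qed

end

theory Submission
  imports Defs "HOL-Real_Asymp.Real_Asymp"
begin

text \<open>
  Take the centred densities \<open>p\<close> and \<open>q\<close> with scatter matrices \<open>I\<close> and \<open>t I\<close>, and write
  \<open>L\<^sub>s x = ln (1 + \<parallel>x\<parallel>\<^sup>2 / s)\<close>. The area of a disc of radius \<open>r\<close> being \<open>\<pi> r\<^sup>2\<close>, integrals of
  functions of \<open>\<parallel>x\<parallel>\<^sup>2\<close> over the plane are one-dimensional, which gives
  \<open>\<integral> p L\<^sub>1 = \<integral> q L\<^sub>t = 2\<close>. From \<open>0 \<le> L\<^sub>t\<close> one gets \<open>KL(p : q) \<ge> ln t - 3\<close>, and from
  \<open>L\<^sub>1 \<le> ln t + L\<^sub>t\<close> one gets \<open>KL(q : p) \<le> ln t / 2\<close>. The two differ once \<open>ln t > 6\<close>.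
\<close>

text \<open>For \<open>a \<ge> 0\<close> the closed disc of radius \<open>sqrt a\<close> has area
  \<open>pi * a\<close>, so the two measures agree on the half-lines \<open>{..a}\<close>. These
  form an intersection-stable generator of the Borel sets, and the \<open>{..real i}\<close> have
  finite measure and exhaust the line.\<close>

lemma distr_norm_power2_lborel:
  "distr (lborel :: (real^2) measure) borel (\<lambda>x. (norm x)\<^sup>2)
     = density lborel (\<lambda>u. ennreal (pi * indicator {0..} u))" (is "?M = ?N")
proof (rule measure_eqI_generator_eq[where E = "range (\<lambda>a. {..a})" and \<Omega> = UNIV
        and A = "\<lambda>i. {..real i}"])
  have emeasures: "emeasure ?M {..a} = ennreal (pi * max 0 a)"
    "emeasure ?N {..a} = ennreal (pi * max 0 a)" for a
  proof -
    have "emeasure ?M {..a} = emeasure lborel {x :: real^2. (norm x)\<^sup>2 \<le> a}"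
      by (subst emeasure_distr) (auto simp: vimage_def)
    also have "{x :: real^2. (norm x)\<^sup>2 \<le> a} = (if a < 0 then {} else cball 0 (sqrt a))"
      by (auto simp: real_le_rsqrt dest: order_trans[OF zero_le_power2])
         (metis norm_ge_zero not_less real_sqrt_le_iff real_sqrt_unique real_sqrt_abs abs_norm_cancel)
    also have "emeasure lborel \<dots> = ennreal (pi * max 0 a)"
      by (auto simp: emeasure_cball unit_ball_vol_2)
    finally show "emeasure ?M {..a} = ennreal (pi * max 0 a)" .
    have "emeasure ?N {..a} = (\<integral>\<^sup>+u. ennreal pi * indicator {0..a} u \<partial>lborel)"
      by (subst emeasure_density) (auto intro!: nn_integral_cong simp: indicator_def)
    also have "\<dots> = ennreal (pi * max 0 a)"
      by (cases "a < 0") (auto simp: nn_integral_cmult ennreal_mult)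
    finally show "emeasure ?N {..a} = ennreal (pi * max 0 a)" .
  qed
  show "emeasure ?M X = emeasure ?N X" if "X \<in> range (\<lambda>a. {..a})" for X
    using that emeasures by auto
  show "emeasure ?M {..real i} \<noteq> \<infinity>" for i
    using emeasures by simp
  show "Int_stable (range (\<lambda>a::real. {..a}))"
    by (auto simp: Int_stable_def)
  show "(\<Union>i. {..real i}) = UNIV"
    using real_arch_simple by auto
  show "sets ?M = sigma_sets UNIV (range (\<lambda>a. {..a}))"
    "sets ?N = sigma_sets UNIV (range (\<lambda>a. {..a}))"
    by (simp_all add: borel_eq_atMost)
qed auto

text \<open>Pushing area forward along the squared norm leaves \<open>pi\<close> times the integral
  of \<open>f\<close> over the half-line, which the fundamental theorem of calculus evaluates. As
  \<open>f\<close> is nonnegative there, the finite value also yields integrability.\<close>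

lemma has_bochner_integral_norm_power2:
  fixes f F :: "real \<Rightarrow> real"
  assumes [measurable]: "f \<in> borel_measurable borel"
    and "\<And>u. 0 \<le> u \<Longrightarrow> DERIV F u :> f u" "\<And>u. 0 \<le> u \<Longrightarrow> 0 \<le> f u" "(F \<longlongrightarrow> T) at_top"
  shows "has_bochner_integral lborel (\<lambda>x :: real^2. f ((norm x)\<^sup>2)) (pi * (T - F 0))"
proof -
  have nn: "(\<integral>\<^sup>+u. ennreal (f u) * indicator {0..} u \<partial>lborel) = ennreal (T - F 0)"
    using assms by (intro nn_integral_FTC_atLeast) auto
  \<comment> \<open>\<open>ennreal\<close> sends negative numbers to 0, so reading
    \<open>ennreal (T - F 0)\<close> back as a real value needs this inequality.\<close>
  have "F 0 \<le> T"
  proof (rule tendsto_lowerbound[OF assms(4)])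
    show "\<forall>\<^sub>F u in at_top. F 0 \<le> F u"
      using eventually_ge_at_top[of 0]
      by eventually_elim (meson DERIV_nonneg_imp_nondecreasing assms(2,3))
  qed simp
  have "has_bochner_integral lborel (\<lambda>u. indicator {0..} u * f u) (T - F 0)"
  proof (rule has_bochner_integral_nn_integral)
    show "(\<integral>\<^sup>+u. ennreal (indicator {0..} u * f u) \<partial>lborel) = ennreal (T - F 0)"
      unfolding nn[symmetric] by (intro nn_integral_cong) (auto simp: indicator_def)
    show "AE u in lborel. 0 \<le> indicator {0..} u * f u"
      using assms(3) by (intro AE_I2) (simp add: indicator_def)
  qed (use \<open>F 0 \<le> T\<close> in auto)
  then have "has_bochner_integral lborel (\<lambda>u. (pi * indicator {0..} u) *\<^sub>R f u) (pi * (T - F 0))"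
    using has_bochner_integral_mult_right[of pi lborel] by (simp add: mult.assoc)
  then have "has_bochner_integral (density lborel (\<lambda>u. ennreal (pi * indicator {0..} u))) f
      (pi * (T - F 0))"
    by (intro has_bochner_integral_density) auto
  then show ?thesis
    unfolding distr_norm_power2_lborel[symmetric]
    by (simp add: has_bochner_integral_iff integrable_distr_eq integral_distr)
qed

lemma mat_mult_vec: "mat c *v x = c *\<^sub>R (x :: real^'n)"
  by (simp add: matrix_vector_mult_def mat_def vec_eq_iff if_distrib[of "\<lambda>a. a * _"] cong: if_cong)

text \<open>\<open>matrix_inv\<close> chooses some two-sided inverse, so an explicit one is
  exhibited first; multiplying by it on the left then identifies the chosen one.\<close>

lemma matrix_inv_mat:
  assumes "c \<noteq> 0"
  shows "matrix_inv (mat c :: real^'n^'n) = mat (1 / c)"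
proof -
  have mult: "mat a ** mat b = (mat (a * b) :: real^'n^'n)" for a b
    by (simp add: matrix_eq mat_mult_vec flip: matrix_vector_mul_assoc)
  have "mat (1 / c) ** mat c = (mat 1 :: real^'n^'n)" "mat c ** mat (1 / c) = (mat 1 :: real^'n^'n)"
    using assms by (simp_all add: mult)
  then have "mat c ** matrix_inv (mat c) = (mat 1 :: real^'n^'n)"
    unfolding matrix_inv_def by (metis (mono_tags, lifting) someI_ex)
  then have "mat (1 / c) ** mat c ** matrix_inv (mat c) = (mat (1 / c) :: real^'n^'n)"
    by (simp add: matrix_mul_assoc[symmetric])
  then show ?thesis
    using \<open>mat (1 / c) ** mat c = mat 1\<close> by simp
qed

lemma sym_pos_def_mat: "0 < c \<Longrightarrow> sym_pos_def (mat c :: real^'n^'n)"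
  by (simp add: sym_pos_def_def mat_mult_vec)

text \<open>In dimension 2 the constant is
  \<open>Gamma (3 / 2) * pi powr (- 3 / 2) = 1 / (2 * pi)\<close>, and the root of the determinant
  is \<open>t\<close>.\<close>

lemma cauchy_density_mat:
  fixes x :: "real^2"
  assumes "0 < t"
  shows "cauchy_density 0 (mat t) x = 1 / (2 * pi * t) * (1 + (norm x)\<^sup>2 / t) powr (- 3 / 2)"
proof -
  have Gamma: "Gamma (3 / 2 :: real) = sqrt pi / 2"
  proof -
    have "(1 / 2 :: real) \<notin> \<int>\<^sub>\<le>\<^sub>0"
      using nonpos_Ints_nonpos[of "1 / 2 :: real"] by auto
    from Gamma_plus1[OF this] show ?thesis
      by (simp add: Gamma_one_half_real)
  qed
  have pi: "pi powr (- 3 / 2) = 1 / (pi * sqrt pi)"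
    using powr_add[of pi 1 "1/2"] by (simp add: powr_minus powr_half_sqrt divide_simps)
  have det: "det (mat t :: real^2^2) = t\<^sup>2"
    by (simp add: det_2 mat_def power2_eq_square)
  show ?thesis
    using assms
    by (simp add: cauchy_density_def Gamma pi[simplified] det matrix_inv_mat mat_mult_vec power2_norm_eq_inner)
qed

lemma has_bochner_integral_cauchy_density_mat:
  assumes "0 < t"
  shows "has_bochner_integral lborel (cauchy_density 0 (mat t :: real^2^2)) 1"
proof -
  \<comment> \<open>An antiderivative in the variable \<open>u\<close>, the squared norm. Its value
    at 0 is \<open>- 1 / pi\<close>, hence total mass 1.\<close>
  let ?F = "\<lambda>u. - 1 / pi * (1 + u / t) powr (- 1 / 2)"
  have "has_bochner_integral lborel (\<lambda>x :: real^2. 1 / (2 * pi * t) * (1 + (norm x)\<^sup>2 / t) powr (- 3 / 2))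
      (pi * (0 - ?F 0))"
  proof (rule has_bochner_integral_norm_power2)
    show "(?F \<longlongrightarrow> 0) at_top"
      using assms by real_asymp
    fix u :: real assume "0 \<le> u"
    with assms have "0 < 1 + u / t"
      by (simp add: add_pos_nonneg)
    with assms show "DERIV ?F u :> 1 / (2 * pi * t) * (1 + u / t) powr (- 3 / 2)"
      by (auto intro!: derivative_eq_intros)
  qed (use assms in auto)
  then show ?thesis
    using assms by (simp add: cauchy_density_mat cong: has_bochner_integral_cong)
qed

lemma has_bochner_integral_cauchy_density_mat_ln:
  assumes "0 < t"
  shows "has_bochner_integral lborel
    (\<lambda>x :: real^2. cauchy_density 0 (mat t) x * ln (1 + (norm x)\<^sup>2 / t)) 2"
proof -
  \<comment> \<open>Found by integration by parts. Its value at 0 is \<open>- 2 / pi\<close>, which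
    gives the integral 2 for every \<open>t\<close>.\<close>
  let ?F = "\<lambda>u. - 1 / pi * ((1 + u / t) powr (- 1 / 2) * (ln (1 + u / t) + 2))"
  have "has_bochner_integral lborel (\<lambda>x :: real^2. 1 / (2 * pi * t) * (1 + (norm x)\<^sup>2 / t) powr (- 3 / 2)
      * ln (1 + (norm x)\<^sup>2 / t)) (pi * (0 - ?F 0))"
  proof (rule has_bochner_integral_norm_power2)
    show "(?F \<longlongrightarrow> 0) at_top"
      using assms by real_asymp
    fix u :: real assume "0 \<le> u"
    with assms have pos: "0 < 1 + u / t"
      by (simp add: add_pos_nonneg)
    \<comment> \<open>With both terms of the product rule on the exponent \<open>- 3 / 2\<close>,
      the summand 2 in \<open>?F\<close> cancels the derivative of the logarithm.\<close>
    have powr: "(1 + u / t) powr (- 1 / 2) = (1 + u / t) powr (- 3 / 2) * (1 + u / t)"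
      using pos powr_add[of "1 + u / t" "- 3 / 2" 1] by simp
    let ?D = "- 1 / pi * (- 1 / 2 * (1 + u / t) powr (- 3 / 2) * (1 / t) * (ln (1 + u / t) + 2)
        + (1 + u / t) powr (- 1 / 2) * (1 / t / (1 + u / t)))"
    have "DERIV ?F u :> ?D"
      using assms pos by (auto intro!: derivative_eq_intros)
    moreover have "(1 + u / t) powr (- 1 / 2) * (1 / t / (1 + u / t)) = (1 + u / t) powr (- 3 / 2) * (1 / t)"
      unfolding powr using pos by simp
    then have "?D = 1 / (2 * pi * t) * (1 + u / t) powr (- 3 / 2) * ln (1 + u / t)"
      using assms by (simp only:) (simp add: divide_simps, simp add: algebra_simps)
    ultimately show "DERIV ?F u :> 1 / (2 * pi * t) * (1 + u / t) powr (- 3 / 2) * ln (1 + u / t)"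
      by simp
  qed (use assms in auto)
  then show ?thesis
    using assms by (simp add: cauchy_density_mat)
qed

lemma ln_cauchy_density_mat_divide:
  fixes x :: "real^2"
  assumes "0 < s" "0 < t"
  shows "ln (cauchy_density 0 (mat s) x / cauchy_density 0 (mat t) x)
    = ln (t / s) + 3 / 2 * (ln (1 + (norm x)\<^sup>2 / t) - ln (1 + (norm x)\<^sup>2 / s))"
proof -
  have "0 < 1 + (norm x)\<^sup>2 / s" "0 < 1 + (norm x)\<^sup>2 / t"
    using assms by (simp_all add: add_pos_nonneg)
  with assms show ?thesis
    by (simp add: cauchy_density_mat ln_div ln_mult ln_powr field_simps)
qed

text \<open>The density has mass 1 and its own logarithmic term has mean 2 at every scale, so only
  the cross term stays unevaluated; bounds on it will suffice. Assumption \<open>int\<close> allows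
  the integral to be split.\<close>

lemma kl_div_cauchy_density_mat:
  fixes s t :: real
  defines "p \<equiv> cauchy_density 0 (mat s :: real^2^2)"
  assumes "0 < s" "0 < t"
    and int: "integrable lborel (\<lambda>x. p x * ln (1 + (norm x)\<^sup>2 / t))"
  shows "kl_div p (cauchy_density 0 (mat t))
    = ln (t / s) + 3 / 2 * ((LINT x|lborel. p x * ln (1 + (norm x)\<^sup>2 / t)) - 2)"
proof -
  note hbi = has_bochner_integral_cauchy_density_mat[OF \<open>0 < s\<close>, folded p_def]
    has_bochner_integral_cauchy_density_mat_ln[OF \<open>0 < s\<close>, folded p_def]
  have "has_bochner_integral lborel
      (\<lambda>x. p x * ln (t / s) + 3 / 2 * (p x * ln (1 + (norm x)\<^sup>2 / t) - p x * ln (1 + (norm x)\<^sup>2 / s)))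
      (1 * ln (t / s) + 3 / 2 * ((LINT x|lborel. p x * ln (1 + (norm x)\<^sup>2 / t)) - 2))"
    by (intro has_bochner_integral_add has_bochner_integral_diff has_bochner_integral_mult_right
        has_bochner_integral_mult_left hbi has_bochner_integral_integrable[OF int])
  then show ?thesis
    using assms(2,3)
    by (simp add: kl_div_def p_def ln_cauchy_density_mat_divide distrib_left right_diff_distrib
        mult.left_commute has_bochner_integral_integral_eq)
qed

theorem proposition8:
  shows "\<exists>(\<mu>\<^sub>1 :: real^2) (\<mu>\<^sub>2 :: real^2) (\<Sigma>\<^sub>1 :: real^2^2) (\<Sigma>\<^sub>2 :: real^2^2).
           sym_pos_def \<Sigma>\<^sub>1 \<and> sym_pos_def \<Sigma>\<^sub>2 \<and>
           kl_div (cauchy_density \<mu>\<^sub>1 \<Sigma>\<^sub>1) (cauchy_density \<mu>\<^sub>2 \<Sigma>\<^sub>2)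
             \<noteq> kl_div (cauchy_density \<mu>\<^sub>2 \<Sigma>\<^sub>2) (cauchy_density \<mu>\<^sub>1 \<Sigma>\<^sub>1)"
proof -
  \<comment> \<open>Any \<open>t\<close> with \<open>ln t > 6\<close> would do; 8 keeps both bounds
    integral.\<close>
  define t :: real where "t = exp 8"
  have t: "1 < t" "0 < t" "ln t = 8"
    by (simp_all add: t_def)
  define L where "L = (\<lambda>s (x :: real^2). ln (1 + (norm x)\<^sup>2 / s))"
  define p where "p = cauchy_density 0 (mat 1 :: real^2^2)"
  define q where "q = cauchy_density 0 (mat t :: real^2^2)"
  have L_nonneg: "0 \<le> L s x" if "0 < s" for s x
    using that by (simp add: L_def)
  have L_t_le: "L t x \<le> L 1 x" for x
  proof -
    have "(norm x)\<^sup>2 / t \<le> (norm x)\<^sup>2 / 1"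
      using t by (intro divide_left_mono) auto
    then show ?thesis
      using t by (simp add: L_def add_pos_nonneg)
  qed
  have L_1_le: "L 1 x \<le> ln t + L t x" for x
  proof -
    have pos: "0 < 1 + (norm x)\<^sup>2 / t"
      using t by (simp add: add_pos_nonneg)
    \<comment> \<open>The right side is \<open>t + (norm x)\<^sup>2\<close>, and
      \<open>1 < t\<close>.\<close>
    have "1 + (norm x)\<^sup>2 \<le> t * (1 + (norm x)\<^sup>2 / t)"
      using t by (simp add: distrib_left)
    then have "L 1 x \<le> ln (t * (1 + (norm x)\<^sup>2 / t))"
      by (simp add: L_def add_pos_nonneg ln_mono)
    also have "\<dots> = ln t + L t x"
      using t pos by (simp add: L_def ln_mult)
    finally show ?thesis .
  qed
  have nonneg: "0 \<le> p x" "0 \<le> q x" for x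
    using t by (simp_all add: p_def q_def cauchy_density_mat)
  have hbi: "has_bochner_integral lborel p 1" "has_bochner_integral lborel q 1"
      "has_bochner_integral lborel (\<lambda>x. p x * L 1 x) 2"
      "has_bochner_integral lborel (\<lambda>x. q x * L t x) 2"
    unfolding p_def q_def L_def using t
    by (intro has_bochner_integral_cauchy_density_mat has_bochner_integral_cauchy_density_mat_ln; simp)+
  have [measurable]: "p \<in> borel_measurable borel" "q \<in> borel_measurable borel"
    using hbi(1,2) by (auto dest: borel_measurable_has_bochner_integral)
  have [measurable]: "L s \<in> borel_measurable borel" for s
    by (simp add: L_def)
  \<comment> \<open>Each cross term is dominated by a function whose integral is known: here through
    \<open>L_t_le\<close>, and for \<open>q\<close> through \<open>L_1_le\<close>.\<close>
  have pL: "integrable lborel (\<lambda>x. p x * L t x)"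
  proof (rule Bochner_Integration.integrable_bound)
    show "integrable lborel (\<lambda>x. p x * L 1 x)"
      using hbi(3) by (simp add: has_bochner_integral_iff)
    show "AE x in lborel. norm (p x * L t x) \<le> norm (p x * L 1 x)"
      using t nonneg L_nonneg L_t_le by (simp add: abs_mult mult_left_mono)
  qed measurable
  have qL': "has_bochner_integral lborel (\<lambda>x. q x * ln t + q x * L t x) (1 * ln t + 2)"
    by (intro has_bochner_integral_add has_bochner_integral_mult_left hbi)
  have qL_le: "q x * L 1 x \<le> q x * ln t + q x * L t x" for x
    using mult_left_mono[OF L_1_le nonneg(2)] by (simp add: distrib_left)
  have qL: "integrable lborel (\<lambda>x. q x * L 1 x)"
  proof (rule Bochner_Integration.integrable_bound)
    show "integrable lborel (\<lambda>x. q x * ln t + q x * L t x)"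
      using qL' by (simp add: has_bochner_integral_iff)
    show "AE x in lborel. norm (q x * L 1 x) \<le> norm (q x * ln t + q x * L t x)"
      using t nonneg L_nonneg qL_le by (intro AE_I2) simp
  qed measurable
  have "0 \<le> (LINT x|lborel. p x * L t x)"
    using t nonneg L_nonneg by (intro Bochner_Integration.integral_nonneg) auto
  moreover have "(LINT x|lborel. q x * L 1 x) \<le> (LINT x|lborel. q x * ln t + q x * L t x)"
    using qL qL' qL_le by (intro integral_mono) (auto simp: has_bochner_integral_iff)
  moreover have "(LINT x|lborel. q x * ln t + q x * L t x) = 10"
    using qL' t by (simp add: has_bochner_integral_integral_eq)
  ultimately have bounds: "0 \<le> (LINT x|lborel. p x * L t x)" "(LINT x|lborel. q x * L 1 x) \<le> 10"
    by simp_all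
  have "kl_div q p = - 8 + 3 / 2 * ((LINT x|lborel. q x * L 1 x) - 2)"
    using kl_div_cauchy_density_mat[of t 1] qL t unfolding p_def q_def L_def by (simp add: ln_div)
  \<comment> \<open>By \<open>bounds\<close>, the left side is at most
    \<open>- 8 + 3 / 2 * 8 = 4\<close> and the right side at least \<open>8 - 3 = 5\<close>.\<close>
  also have "\<dots> < 8 + 3 / 2 * ((LINT x|lborel. p x * L t x) - 2)"
    using bounds by (simp add: field_simps)
  also have "\<dots> = kl_div p q"
    using kl_div_cauchy_density_mat[of 1 t] pL t unfolding p_def q_def L_def by simp
  finally have "kl_div q p < kl_div p q" .
  then show ?thesis
    using t sym_pos_def_mat[of 1] sym_pos_def_mat[of t] unfolding p_def q_def
    by (intro exI[of _ 0] exI[of _ "mat 1"] exI[of _ "mat t"]) auto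
qed

end
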